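(* Let $\Omega$ be a bounded convex set in the plane, not reduced to a segment. Let $n\ge 3$ be an integer and $A\in(0,|\Omega|)$. Let $P^*$ be a convex polygon maximizing the perimeter among convex polygons $P$ with at most $n$ sides that are contained in $\Omega$ and have fixed area $|P|=A$. Then $P^*$ is inscribed in $\Omega$, i.e. all vertices of $P^*$ belong to $\partial\Omega$.
   Context: $|\cdot|$ denotes the area. Vertices of a polygon are understood to be non-redundant: they are distinct and no three of them are collinear. *)

theory Defs
  imports "HOL-Analysis.Analysis"
begin

text \<open>
  A convex polygon is the filled two-dimensional region. Its vertices are its extreme points and
  its sides are its edges in the sense of the face lattice, so that both are automatically
  non-redundant; see \<open>vertices_not_collinear\<close> below.
\<close>

definition convex_polygon :: "(real ^ 2) set \<Rightarrow> bool" where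
  "convex_polygon P \<longleftrightarrow> polytope P \<and> aff_dim P = 2"

definition vertices :: "(real ^ 2) set \<Rightarrow> (real ^ 2) set" where
  "vertices P = {v. v extreme_point_of P}"

definition sides :: "(real ^ 2) set \<Rightarrow> (real ^ 2) set set" where
  "sides P = {e. e edge_of P}"

text \<open>A side is a segment, and the length of a segment is its diameter; see \<open>side_segment\<close>.\<close>

definition perimeter :: "(real ^ 2) set \<Rightarrow> real" where
  "perimeter P = (\<Sum>e\<in>sides P. diameter e)"

text \<open>
  A bounded convex set need not be Borel, but it is Lebesgue measurable, hence the completed
  measure.
\<close>

definition area :: "(real ^ 2) set \<Rightarrow> real" where
  "area S = measure lebesgue S"

lemma finite_sides:
  assumes "convex_polygon P"
  shows "finite (sides P)"
proof -
  have "finite {F. F face_of P}"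
    using assms finite_polytope_faces by (auto simp: convex_polygon_def)
  then show ?thesis
    by (rule rev_finite_subset) (auto simp: sides_def edge_of_def)
qed

lemma vertices_not_collinear:
  assumes "a \<in> vertices P" "b \<in> vertices P" "c \<in> vertices P" "a \<noteq> b" "b \<noteq> c" "a \<noteq> c"
  shows "\<not> collinear {a, b, c}"
  using assms
  by (auto simp: collinear_between_cases vertices_def extreme_point_of_def between_mem_segment
      open_segment_def insert_commute)

lemma side_segment:
  assumes "convex_polygon P" "e \<in> sides P"
  shows "\<exists>a\<in>vertices P. \<exists>b\<in>vertices P. a \<noteq> b \<and> e = closed_segment a b \<and> diameter e = dist a b"
proof -
  have e: "e face_of P" "aff_dim e = 1"
    using assms by (auto simp: sides_def edge_of_def)
  have "polytope e"
    using assms e face_of_polytope_polytope by (auto simp: convex_polygon_def)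
  then have "compact e" "convex e"
    by (auto simp: polytope_imp_compact polytope_imp_convex)
  moreover have "collinear e" "e \<noteq> {}"
    using e by (auto simp: collinear_aff_dim)
  ultimately obtain a b where ab: "e = closed_segment a b"
    using compact_convex_collinear_segment by metis
  have dist_le: "dist x y \<le> dist a b"
    if "x \<in> closed_segment a b" "y \<in> closed_segment a b" for x y
    using dist_decreases_closed_segment[OF that(1), of y] dist_in_closed_segment[OF that(2)]
    by (auto simp: dist_commute)
  have "a \<noteq> b"
    using ab e by auto
  moreover have "a extreme_point_of P" "b extreme_point_of P"
    using ab e extreme_point_of_face[OF e(1)] by (auto simp: extreme_point_of_segment)
  moreover have "diameter e = dist a b"
  proof (rule antisym)
    show "diameter e \<le> dist a b"
      unfolding ab
      by (rule diameter_le) (auto simp: dist_norm[symmetric] intro: dist_le)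
    show "dist a b \<le> diameter e"
      using ab by (auto intro!: diameter_bounded_bound bounded_closed_segment)
  qed
  ultimately show ?thesis
    using ab unfolding vertices_def by blast
qed

end

theory Submission
  imports Defs
begin

text \<open>
  A vertex \<open>v\<close> of a polygon \<open>P\<close> that lies in the interior of \<open>\<Omega>\<close> has room to move. Let \<open>u\<close> and \<open>w\<close> be
  its two neighbours and slide \<open>v\<close> along the line through \<open>v\<close> parallel to \<open>u w\<close>, leaving the other
  vertices where they are. Then \<open>P\<close> is the union of the polygon spanned by the other vertices and
  the triangle \<open>u v w\<close>, and neither the base nor the height of this triangle changes, so the area
  stays the same. On the other hand, the distances from \<open>v\<close> to \<open>u\<close> and to \<open>w\<close> are strictly convex
  functions of the displacement, because neither \<open>u\<close> nor \<open>w\<close> lies on the line of motion. Hence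
  sliding by the same small amount in one of the two opposite directions strictly increases the
  perimeter (\<open>exists_larger_perimeter\<close>), and \<open>P\<close> is not optimal.

  What has to be justified is that a small displacement does not change the combinatorics of \<open>P\<close>.
  All combinatorial information sits in the signs of the determinants \<open>orient a b c\<close> of triples of
  vertices: the sides of the convex hull of a finite set in general position are the segments
  \<open>a b\<close> with all remaining points strictly to the left of \<open>a b\<close> (\<open>bij_betw_ccw_edges_sides\<close>).
  Since no three vertices are collinear, these finitely many determinants are nonzero, so their
  signs survive small displacements, and with them the sides (\<open>ccw_edges_image\<close>) and the
  decomposition of the area (\<open>area_cut_vertex\<close>).
\<close>

section \<open>Orientation of triples of points\<close>

text \<open>
  Twice the signed area of the triangle \<open>a b c\<close>; it is positive iff \<open>c\<close> lies strictly to the left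
  of the directed line from \<open>a\<close> to \<open>b\<close>.
\<close>

definition orient :: "real ^ 2 \<Rightarrow> real ^ 2 \<Rightarrow> real ^ 2 \<Rightarrow> real" where
  "orient a b c = (b $ 1 - a $ 1) * (c $ 2 - a $ 2) - (b $ 2 - a $ 2) * (c $ 1 - a $ 1)"

lemma orient_rotate: "orient b c a = orient a b c"
  by (simp add: orient_def algebra_simps)

lemma orient_swap: "orient b a c = - orient a b c"
  by (simp add: orient_def algebra_simps)

lemma orient_same [simp]: "orient a a c = 0" "orient a b a = 0" "orient a b b = 0"
  by (simp_all add: orient_def algebra_simps)

lemma orient_affine:
  "orient a b ((1 - t) *\<^sub>R x + t *\<^sub>R y) = (1 - t) * orient a b x + t * orient a b y"
  by (simp add: orient_def algebra_simps)

text \<open>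
  As a function of its last argument, the determinant is affine, so its sign conditions cut out
  half-planes.\<close>

lemma orient_inner:
  "orient a b c = vector [a $ 2 - b $ 2, b $ 1 - a $ 1] \<bullet> c
                - (vector [a $ 2 - b $ 2, b $ 1 - a $ 1] :: real ^ 2) \<bullet> a"
  by (simp add: orient_def inner_vec_def sum_2 algebra_simps)

lemma convex_orient_ge: "convex {x. 0 \<le> orient a b x}"
  unfolding orient_inner by (simp add: convex_halfspace_ge)

lemma convex_orient_gt: "convex {x. 0 < orient a b x}"
  unfolding orient_inner by (simp add: convex_halfspace_gt)

lemma negligible_orient_zero:
  assumes "a \<noteq> b"
  shows "negligible {x. orient a b x = 0}"
proof -
  have "(vector [a $ 2 - b $ 2, b $ 1 - a $ 1] :: real ^ 2) \<noteq> 0"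
    using assms by (auto simp: vec_eq_iff forall_2)
  then show ?thesis
    unfolding orient_inner by (simp add: negligible_hyperplane)
qed

lemma collinear_iff_orient: "collinear {a, b, c} \<longleftrightarrow> orient a b c = 0"
proof
  assume "collinear {a, b, c}"
  then have "a = b \<or> c = b \<or> (\<exists>k. c - b = k *\<^sub>R (a - b))"
    by (auto simp: collinear_3[of a b c] collinear_lemma)
  then show "orient a b c = 0"
  proof (elim disjE exE)
    fix k
    assume "c - b = k *\<^sub>R (a - b)"
    from arg_cong[OF this, of "\<lambda>z. z $ 1"] arg_cong[OF this, of "\<lambda>z. z $ 2"]
    have "c $ 1 = b $ 1 + k * (a $ 1 - b $ 1)" "c $ 2 = b $ 2 + k * (a $ 2 - b $ 2)"
      by (simp_all add: algebra_simps)
    then show ?thesis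
      by (simp only: orient_def) (simp add: algebra_simps)
  qed simp_all
next
  assume 0: "orient a b c = 0"
  show "collinear {a, b, c}"
  proof (cases "a = b")
    case False
    define d e where "d = a - b" and "e = c - b"
    have "d $ 1 \<noteq> 0 \<or> d $ 2 \<noteq> 0"
      using False by (auto simp: d_def vec_eq_iff forall_2)
    moreover have "d $ 1 * e $ 2 = d $ 2 * e $ 1"
      using 0 by (simp add: orient_def d_def e_def algebra_simps)
    ultimately have "e = (e $ 1 / d $ 1) *\<^sub>R d \<or> e = (e $ 2 / d $ 2) *\<^sub>R d"
      unfolding vec_eq_iff forall_2 by (auto simp: field_simps)
    then have "\<exists>k. e = k *\<^sub>R d"
      by blast
    then show ?thesis
      using collinear_3[of a b c] collinear_lemma[of d e] by (simp add: d_def e_def)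
  qed simp
qed

lemma orient_affine_hull: "x \<in> affine hull {a, b} \<Longrightarrow> orient a b x = 0"
  by (auto simp: affine_hull_2_alt orient_def algebra_simps)

text \<open>
  The three determinants are, up to the common factor \<open>orient a b c\<close>, the barycentric coordinates
  of \<open>x\<close> (Cramer's rule).\<close>

lemma mem_triangle_if_orient_nonneg:
  assumes D: "0 < orient a b c"
    and nonneg: "0 \<le> orient b c x" "0 \<le> orient c a x" "0 \<le> orient a b x"
  shows "x \<in> convex hull {a, b, c}"
proof -
  define D where "D = orient a b c"
  have "D * x $ i = orient b c x * a $ i + orient c a x * b $ i + orient a b x * c $ i" for i
    using exhaust_2[of i] by (auto simp: D_def orient_def algebra_simps)
  then have "x = (orient b c x / D) *\<^sub>R a + (orient c a x / D) *\<^sub>R b + (orient a b x / D) *\<^sub>R c"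
    using D by (simp add: D_def[symmetric] vec_eq_iff field_simps)
  moreover have "orient b c x + orient c a x + orient a b x = D"
    by (simp add: D_def orient_def algebra_simps)
  then have "orient b c x / D + orient c a x / D + orient a b x / D = 1"
    using D by (simp add: D_def[symmetric] add_divide_distrib[symmetric])
  moreover have "0 \<le> orient b c x / D" "0 \<le> orient c a x / D" "0 \<le> orient a b x / D"
    using D nonneg by (simp_all add: D_def)
  ultimately show ?thesis
    unfolding convex_hull_3 by blast
qed

section \<open>Edges of a polygon in terms of orientations\<close>

text \<open>
  At least three points are required so that the hull is two-dimensional and each side has a point
  off its line, which determines its counterclockwise direction.
\<close>

definition general_position :: "(real ^ 2) set \<Rightarrow> bool" where
  "general_position V \<longleftrightarrow> finite V \<and> 3 \<le> card V \<and>
     (\<forall>a\<in>V. \<forall>b\<in>V. \<forall>c\<in>V. a \<noteq> b \<longrightarrow> b \<noteq> c \<longrightarrow> a \<noteq> c \<longrightarrow> orient a b c \<noteq> 0)"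

definition ccw_edges :: "(real ^ 2) set \<Rightarrow> ((real ^ 2) \<times> (real ^ 2)) set" where
  "ccw_edges V = {(a, b). a \<in> V \<and> b \<in> V \<and> a \<noteq> b \<and> (\<forall>c\<in>V - {a, b}. 0 < orient a b c)}"

lemma ccw_edges_orient_nonneg: "(a, b) \<in> ccw_edges V \<Longrightarrow> x \<in> V \<Longrightarrow> 0 \<le> orient a b x"
  by (cases "x \<in> {a, b}") (auto simp: ccw_edges_def intro: less_imp_le)

lemma general_positionD:
  assumes "general_position V" "a \<in> V" "b \<in> V" "c \<in> V" "a \<noteq> b" "b \<noteq> c" "a \<noteq> c"
  shows "orient a b c \<noteq> 0"
  using assms unfolding general_position_def by blast

lemma general_position_third:
  assumes "general_position V"
  obtains c where "c \<in> V" "c \<noteq> a" "c \<noteq> b"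
proof -
  have "card {a, b} < card V"
    using assms card_2_iff by (auto simp: general_position_def card_insert_if)
  then have "\<not> V \<subseteq> {a, b}"
    using card_mono[of "{a, b}" V] by auto
  then show thesis using that by auto
qed

lemma convex_polygon_hull:
  assumes "general_position V"
  shows "convex_polygon (convex hull V)"
proof -
  obtain a where a: "a \<in> V" using general_position_third[OF assms] by blast
  obtain b where b: "b \<in> V" "b \<noteq> a" using general_position_third[OF assms] by blast
  obtain c where c: "c \<in> V" "c \<noteq> a" "c \<noteq> b" using general_position_third[OF assms] by blast
  have "\<not> collinear {a, b, c}"
    using assms a b c by (auto simp: general_position_def collinear_iff_orient)
  then have "\<not> collinear V"
    using collinear_subset[of V "{a, b, c}"] a b c by auto
  moreover have "aff_dim V \<le> 2"
    using aff_dim_le_DIM[of V] by simp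
  ultimately have "aff_dim V = 2"
    by (simp add: collinear_aff_dim)
  then show ?thesis
    using assms by (auto simp: convex_polygon_def general_position_def aff_dim_convex_hull polytope_def)
qed

text \<open>
  The hull of the remaining points lies strictly to the left of the line \<open>a b\<close> and thus misses it,
  so the hull of \<open>{a, b}\<close> is a face.\<close>

lemma side_if_ccw_edge:
  assumes V: "general_position V" and ab: "(a, b) \<in> ccw_edges V"
  shows "closed_segment a b \<in> sides (convex hull V)"
proof -
  have "convex hull (V - {a, b}) \<subseteq> {x. 0 < orient a b x}"
    using ab by (intro hull_minimal convex_orient_gt) (auto simp: ccw_edges_def)
  then have "disjnt (affine hull {a, b}) (convex hull (V - {a, b}))"
    using orient_affine_hull[of _ a b] by (fastforce simp: disjnt_def)
  then have "convex hull {a, b} face_of convex hull V"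
    using face_of_convex_hulls[of V "{a, b}"] V ab by (auto simp: disjnt_def ccw_edges_def general_position_def)
  moreover have "aff_dim (convex hull {a, b}) = 1"
    using ab by (simp add: ccw_edges_def aff_dim_convex_hull)
  ultimately show ?thesis
    by (simp add: sides_def edge_of_def segment_convex_hull)
qed

text \<open>
  A side is the hull of some of the points; being one-dimensional, it is spanned by exactly two,
  \<open>a\<close> and \<open>b\<close>, as no three points are collinear. Faces of polyhedra are exposed, and in the plane a
  linear functional that is constant on the line \<open>a b\<close> is, up to a constant, a multiple of
  \<open>orient a b\<close>. So a functional exposing the side shows that all other points are on the same side
  of the line.\<close>

lemma side_imp_ccw_edge:
  assumes V: "general_position V" and e: "e \<in> sides (convex hull V)"
  obtains a b where "(a, b) \<in> ccw_edges V" "e = closed_segment a b"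
proof -
  have face: "e face_of convex hull V" and dim: "aff_dim e = 1"
    using e by (auto simp: sides_def edge_of_def)
  have "finite V" using V by (simp add: general_position_def)
  obtain S where S: "S \<subseteq> V" "e = convex hull S"
    using face_of_convex_hull_subset[OF finite_imp_compact[OF \<open>finite V\<close>] face] .
  have dimS: "aff_dim S = 1"
    using dim S by (simp add: aff_dim_convex_hull)
  obtain a where a: "a \<in> S" using dimS by fastforce
  have "S \<noteq> {a}" using dimS by auto
  then obtain b where b: "b \<in> S" "b \<noteq> a" using a by auto
  have "S \<subseteq> {a, b}"
  proof
    fix c assume c: "c \<in> S"
    have "collinear {a, b, c}"
      using dimS a b c collinear_subset[of S "{a, b, c}"] by (auto simp: collinear_aff_dim)
    moreover have "a \<in> V" "b \<in> V" "c \<in> V" using S a b c by auto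
    ultimately show "c \<in> {a, b}"
      using general_positionD[OF V, of a b c] b by (auto simp: collinear_iff_orient)
  qed
  then have "S = {a, b}"
    using a b by auto
  then have seg: "e = closed_segment a b"
    using S by (simp add: segment_convex_hull)
  have "polyhedron (convex hull V)"
    using \<open>finite V\<close> by (auto intro!: polytope_imp_polyhedron simp: polytope_def)
  then have "e exposed_face_of convex hull V"
    using face by (simp add: exposed_face_of_polyhedron)
  then obtain p r where sub: "convex hull V \<subseteq> {x. p \<bullet> x \<le> r}"
    and eq: "e = convex hull V \<inter> {x. p \<bullet> x = r}"
    by (auto simp: exposed_face_of_def)
  have pab: "p \<bullet> a = r" "p \<bullet> b = r"
    using eq seg by auto
  have strict: "p \<bullet> c < r" if c: "c \<in> V - {a, b}" for c
  proof -
    have "c \<notin> e"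
    proof
      assume "c \<in> e"
      then have "c \<in> affine hull {a, b}"
        using seg convex_hull_subset_affine_hull by (auto simp: segment_convex_hull)
      then have "orient a b c = 0" by (rule orient_affine_hull)
      then show False
        using general_positionD[OF V, of a b c] S a b c by auto
    qed
    then show ?thesis
      using c sub eq hull_inc[of c V convex] by fastforce
  qed
  (* p is perpendicular to b - a, hence k / N times b - a turned by a right angle. *)
  define k where "k = p $ 2 * (b $ 1 - a $ 1) - p $ 1 * (b $ 2 - a $ 2)"
  define N where "N = (b $ 1 - a $ 1)\<^sup>2 + (b $ 2 - a $ 2)\<^sup>2"
  have pb: "p $ 1 * (b $ 1 - a $ 1) + p $ 2 * (b $ 2 - a $ 2) = 0"
    using pab by (simp add: inner_vec_def sum_2 algebra_simps)
  have N: "N > 0"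
    using b by (auto simp: N_def sum_power2_gt_zero_iff vec_eq_iff forall_2)
  have rel: "N * (p \<bullet> c - r) = k * orient a b c" for c
  proof -
    have "N * (p \<bullet> c - p \<bullet> a) = k * orient a b c
       + (p $ 1 * (b $ 1 - a $ 1) + p $ 2 * (b $ 2 - a $ 2))
         * ((b $ 1 - a $ 1) * (c $ 1 - a $ 1) + (b $ 2 - a $ 2) * (c $ 2 - a $ 2))"
      by (simp add: N_def k_def orient_def inner_vec_def sum_2 power2_eq_square algebra_simps)
    then show ?thesis using pb pab by simp
  qed
  have neg: "k * orient a b c < 0" if "c \<in> V - {a, b}" for c
    using strict[OF that] N rel[of c] by (metis diff_less_0_iff_less mult_pos_neg)
  have mem: "a \<in> V" "b \<in> V" using S a b by auto
  show thesis
  proof (cases "k < 0")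
    case True
    then have "(a, b) \<in> ccw_edges V"
      using neg mem b by (auto simp: ccw_edges_def mult_less_0_iff)
    then show thesis using that seg by blast
  next
    case False
    then have "(b, a) \<in> ccw_edges V"
      using neg mem b by (auto simp: ccw_edges_def mult_less_0_iff orient_swap[of b a])
    then show thesis using that seg by (metis closed_segment_commute)
  qed
qed

text \<open>
  The direction of a side is determined by any third point, so distinct pairs give distinct
  segments.\<close>

lemma bij_betw_ccw_edges_sides:
  assumes V: "general_position V"
  shows "bij_betw (\<lambda>(a, b). closed_segment a b) (ccw_edges V) (sides (convex hull V))"
  unfolding bij_betw_def
proof (intro conjI set_eqI)
  have "\<not> ((a, b) \<in> ccw_edges V \<and> (b, a) \<in> ccw_edges V)" for a b
  proof
    assume *: "(a, b) \<in> ccw_edges V \<and> (b, a) \<in> ccw_edges V"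
    obtain c where "c \<in> V" "c \<noteq> a" "c \<noteq> b" using general_position_third[OF V] .
    then have "0 < orient a b c" "0 < orient b a c" using * by (auto simp: ccw_edges_def)
    then show False using orient_swap[of a b c] by linarith
  qed
  then show "inj_on (\<lambda>(a, b). closed_segment a b) (ccw_edges V)"
    by (auto simp: inj_on_def doubleton_eq_iff)
next
  fix e
  show "e \<in> (\<lambda>(a, b). closed_segment a b) ` ccw_edges V \<longleftrightarrow> e \<in> sides (convex hull V)"
    using side_if_ccw_edge[OF V] by (auto elim: side_imp_ccw_edge[OF V])
qed

lemma diameter_closed_segment:
  fixes a b :: "'a :: euclidean_space"
  shows "diameter (closed_segment a b) = dist a b"
proof (rule antisym)
  show "diameter (closed_segment a b) \<le> dist a b"
  proof (rule diameter_le)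
    show "norm (x - y) \<le> dist a b" if "x \<in> closed_segment a b" "y \<in> closed_segment a b" for x y
      using dist_decreases_closed_segment[OF that(1), of y] dist_in_closed_segment[OF that(2)]
      by (auto simp: dist_commute dist_norm[symmetric])
  qed simp
  show "dist a b \<le> diameter (closed_segment a b)"
    by (intro diameter_bounded_bound bounded_closed_segment) auto
qed

lemma perimeter_eq_sum_ccw_edges:
  assumes "general_position V"
  shows "perimeter (convex hull V) = (\<Sum>(a, b)\<in>ccw_edges V. dist a b)"
  unfolding perimeter_def
  by (subst sum.reindex_bij_betw[OF bij_betw_ccw_edges_sides[OF assms], symmetric])
     (simp add: case_prod_unfold diameter_closed_segment)

section \<open>Orientation-preserving displacements of the vertices\<close>

definition orient_preserving_on :: "(real ^ 2) set \<Rightarrow> (real ^ 2 \<Rightarrow> real ^ 2) \<Rightarrow> bool" where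
  "orient_preserving_on V f \<longleftrightarrow>
     (\<forall>a\<in>V. \<forall>b\<in>V. \<forall>c\<in>V. 0 < orient a b c \<longrightarrow> 0 < orient (f a) (f b) (f c))"

text \<open>
  Exchanging the first two arguments flips the sign, so preserving positive signs means preserving
  negative signs as well.\<close>

lemma orient_preserving_sgn:
  assumes "orient_preserving_on V f" "a \<in> V" "b \<in> V" "c \<in> V" "orient a b c \<noteq> 0"
  shows "orient (f a) (f b) (f c) \<noteq> 0" "0 < orient (f a) (f b) (f c) \<longleftrightarrow> 0 < orient a b c"
proof -
  have *: "0 < orient x y z \<Longrightarrow> 0 < orient (f x) (f y) (f z)" if "x \<in> V" "y \<in> V" "z \<in> V" for x y z
    using assms(1) that unfolding orient_preserving_on_def by blast
  have "0 < orient a b c \<or> 0 < orient b a c"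
    using assms(5) orient_swap[of b a c] by linarith
  then have "0 < orient a b c \<and> 0 < orient (f a) (f b) (f c) \<or>
             0 < orient b a c \<and> 0 < orient (f b) (f a) (f c)"
    using assms * by blast
  then show "orient (f a) (f b) (f c) \<noteq> 0" "0 < orient (f a) (f b) (f c) \<longleftrightarrow> 0 < orient a b c"
    using orient_swap[of b a c] orient_swap[of "f b" "f a" "f c"] by linarith+
qed

text \<open>Two points with the same image would make a degenerate triple with any third point.\<close>

lemma orient_preserving_inj_on:
  assumes V: "general_position V" and f: "orient_preserving_on V f"
  shows "inj_on f V"
proof (rule inj_onI, rule ccontr)
  fix a b assume ab: "a \<in> V" "b \<in> V" "f a = f b" "a \<noteq> b"
  obtain c where "c \<in> V" "c \<noteq> a" "c \<noteq> b" using general_position_third[OF V] .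
  then have "orient (f a) (f b) (f c) \<noteq> 0"
    using general_positionD[OF V, of a b c] ab by (intro orient_preserving_sgn(1)[OF f]) auto
  then show False using ab by simp
qed

lemma orient_preserving_general_position:
  assumes V: "general_position V" and f: "orient_preserving_on V f"
  shows "general_position (f ` V)"
proof -
  have "card (f ` V) = card V"
    by (rule card_image[OF orient_preserving_inj_on[OF assms]])
  moreover have "orient (f a) (f b) (f c) \<noteq> 0"
    if "a \<in> V" "b \<in> V" "c \<in> V" "f a \<noteq> f b" "f b \<noteq> f c" "f a \<noteq> f c" for a b c
    using general_positionD[OF V, of a b c] that by (intro orient_preserving_sgn(1)[OF f]) auto
  ultimately show ?thesis
    using V by (auto simp: general_position_def)
qed

text \<open>
  Membership in \<open>ccw_edges\<close> depends on the signs of orientations only, so the displaced points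
  have the same combinatorics.\<close>

lemma ccw_edges_image:
  assumes V: "general_position V" and f: "orient_preserving_on V f"
  shows "bij_betw (map_prod f f) (ccw_edges V) (ccw_edges (f ` V))"
proof -
  note inj = orient_preserving_inj_on[OF V f]
  have sub: "ccw_edges V \<subseteq> V \<times> V" by (auto simp: ccw_edges_def)
  have iff: "(f a, f b) \<in> ccw_edges (f ` V) \<longleftrightarrow> (a, b) \<in> ccw_edges V"
    if ab: "a \<in> V" "b \<in> V" for a b
  proof (cases "a = b")
    case False
    have "f a \<noteq> f b" using False inj ab by (auto dest: inj_onD)
    have "f ` V - {f a, f b} = f ` (V - {a, b})"
      using inj_on_image_set_diff[OF inj, of V "{a, b}"] ab by auto
    moreover have "0 < orient (f a) (f b) (f c) \<longleftrightarrow> 0 < orient a b c" if "c \<in> V - {a, b}" for c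
      using general_positionD[OF V, of a b c] ab that False
      by (intro orient_preserving_sgn(2)[OF f]) auto
    ultimately show ?thesis
      using ab False \<open>f a \<noteq> f b\<close> by (simp add: ccw_edges_def)
  qed (simp add: ccw_edges_def)
  have "map_prod f f ` ccw_edges V = ccw_edges (f ` V)"
  proof (intro equalityI subsetI)
    fix p assume p: "p \<in> ccw_edges (f ` V)"
    then obtain a b where "p = (f a, f b)" "a \<in> V" "b \<in> V"
      by (auto simp: ccw_edges_def)
    then show "p \<in> map_prod f f ` ccw_edges V"
      using p iff by (force simp: image_iff)
  next
    fix p assume "p \<in> map_prod f f ` ccw_edges V"
    then show "p \<in> ccw_edges (f ` V)"
      using iff sub by auto
  qed
  moreover have "inj_on (map_prod f f) (ccw_edges V)"
    using map_prod_inj_on[OF inj inj] sub by (rule inj_on_subset)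
  ultimately show ?thesis by (simp add: bij_betw_def)
qed

lemma card_sides_image:
  assumes "general_position V" "orient_preserving_on V f"
  shows "card (sides (convex hull f ` V)) = card (sides (convex hull V))"
  using bij_betw_same_card[OF ccw_edges_image[OF assms]]
    bij_betw_same_card[OF bij_betw_ccw_edges_sides[OF assms(1)]]
    bij_betw_same_card[OF bij_betw_ccw_edges_sides[OF orient_preserving_general_position[OF assms]]]
  by simp

lemma perimeter_image:
  assumes "general_position V" "orient_preserving_on V f"
  shows "perimeter (convex hull f ` V) = (\<Sum>(a, b)\<in>ccw_edges V. dist (f a) (f b))"
  unfolding perimeter_eq_sum_ccw_edges[OF orient_preserving_general_position[OF assms]]
  by (subst sum.reindex_bij_betw[OF ccw_edges_image[OF assms], symmetric])
     (simp add: case_prod_unfold)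

section \<open>The neighbours of a vertex\<close>

text \<open>
  Separate \<open>v\<close> from the other points by a functional \<open>p\<close>. Seen from \<open>v\<close>, all other points are in
  the open half-plane of directions where \<open>p\<close> is positive, so they are linearly ordered by angle,
  that is, by the tangent of the angle with \<open>p\<close>. The first and the last of them are the neighbours
  of \<open>v\<close>.\<close>

lemma exists_ccw_neighbour:
  assumes V: "general_position V" and v: "v \<in> V" "v \<notin> convex hull (V - {v})"
  shows "\<exists>w\<in>V. (v, w) \<in> ccw_edges V" "\<exists>u\<in>V. (u, v) \<in> ccw_edges V"
proof -
  have fin: "finite (V - {v})" using V by (simp add: general_position_def)
  obtain y where "y \<in> V" "y \<noteq> v" using general_position_third[OF V] by blast
  then have ne: "V - {v} \<noteq> {}" by blast
  obtain p r where p: "p \<bullet> v < r" "\<forall>x\<in>convex hull (V - {v}). r < p \<bullet> x"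
    using separating_hyperplane_closed_point[OF convex_convex_hull _ v(2)]
      compact_imp_closed[OF finite_imp_compact_convex_hull[OF fin]] by blast
  have pos: "0 < p \<bullet> (x - v)" if "x \<in> V - {v}" for x
    using p hull_inc[OF that, of convex] by (fastforce simp: inner_diff_right)
  define slope where "slope x = orient 0 p (x - v) / (p \<bullet> (x - v))" for x
  have "p \<noteq> 0" using pos ne by fastforce
  have mono: "0 < orient v x y" if x: "x \<in> V - {v}" and y: "y \<in> V - {v}" and "x \<noteq> y"
    and le: "slope x \<le> slope y" for x y
  proof -
    (* Plane vectors satisfy a Pluecker relation that writes their determinant in terms of their
       components along and across p. *)
    have "(p \<bullet> p) * orient v x y
          = (p \<bullet> (x - v)) * orient 0 p (y - v) - (p \<bullet> (y - v)) * orient 0 p (x - v)"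
      by (simp add: orient_def inner_vec_def sum_2 algebra_simps)
    also have "\<dots> \<ge> 0"
      using le pos[OF x] pos[OF y] by (simp add: slope_def field_simps)
    finally have "0 \<le> orient v x y"
      using \<open>p \<noteq> 0\<close> by (simp add: zero_le_mult_iff flip: inner_gt_zero_iff)
    moreover have "orient v x y \<noteq> 0"
      using general_positionD[OF V, of v x y] v x y \<open>x \<noteq> y\<close> by auto
    ultimately show ?thesis by simp
  qed
  obtain w where "is_arg_min slope (\<lambda>x. x \<in> V - {v}) w"
    using ex_is_arg_min_if_finite[OF fin ne] by blast
  then have w: "w \<in> V - {v}" "\<And>x. x \<in> V - {v} \<Longrightarrow> slope w \<le> slope x"
    by (auto simp: is_arg_min_linorder)
  then show "\<exists>w\<in>V. (v, w) \<in> ccw_edges V"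
    using mono v by (intro bexI[of _ w]) (auto simp: ccw_edges_def)
  obtain u where "is_arg_min (\<lambda>x. - slope x) (\<lambda>x. x \<in> V - {v}) u"
    using ex_is_arg_min_if_finite[OF fin ne] by blast
  then have u: "u \<in> V - {v}" "\<And>x. x \<in> V - {v} \<Longrightarrow> slope x \<le> slope u"
    by (auto simp: is_arg_min_linorder)
  then show "\<exists>u\<in>V. (u, v) \<in> ccw_edges V"
    using mono v orient_rotate[of v] by (intro bexI[of _ u]) (auto simp: ccw_edges_def)
qed

lemma ccw_edges_unique:
  assumes "(v, w) \<in> ccw_edges V" "(v, w') \<in> ccw_edges V"
  shows "w = w'"
proof (rule ccontr)
  assume "w \<noteq> w'"
  then have "0 < orient v w w'" "0 < orient v w' w" using assms by (auto simp: ccw_edges_def)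
  then show False by (simp add: orient_def algebra_simps)
qed

lemma ccw_edges_unique':
  assumes "(u, v) \<in> ccw_edges V" "(u', v) \<in> ccw_edges V"
  shows "u = u'"
proof (rule ccontr)
  assume "u \<noteq> u'"
  then have "0 < orient u v u'" "0 < orient u' v u" using assms by (auto simp: ccw_edges_def)
  then show False by (simp add: orient_def algebra_simps)
qed

text \<open>
  A point on the same side of the chord \<open>u w\<close> as \<open>v\<close> would lie in the triangle \<open>u v w\<close>, because it
  is to the left of \<open>u v\<close> and of \<open>v w\<close>; then it would not be extreme.\<close>

lemma orient_neighbours:
  assumes V: "general_position V" and conv: "\<And>x. x \<in> V \<Longrightarrow> x \<notin> convex hull (V - {x})"
    and uv: "(u, v) \<in> ccw_edges V" and vw: "(v, w) \<in> ccw_edges V"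
  shows "0 < orient u v w" "\<And>x. x \<in> V - {u, v, w} \<Longrightarrow> 0 < orient u w x"
proof -
  have mem: "u \<in> V" "v \<in> V" "w \<in> V" "u \<noteq> v" "v \<noteq> w"
    using uv vw by (auto simp: ccw_edges_def)
  have "u \<noteq> w"
  proof
    assume "u = w"
    obtain c where "c \<in> V" "c \<noteq> u" "c \<noteq> v" using general_position_third[OF V] .
    then have "0 < orient u v c" "0 < orient v u c"
      using uv vw \<open>u = w\<close> by (auto simp: ccw_edges_def)
    then show False using orient_swap[of u v c] by linarith
  qed
  then show D: "0 < orient u v w"
    using uv mem by (auto simp: ccw_edges_def)
  show "0 < orient u w x" if x: "x \<in> V - {u, v, w}" for x
  proof (rule ccontr)
    assume "\<not> 0 < orient u w x"
    then have "0 \<le> orient w u x" using orient_swap[of u w x] by linarith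
    moreover have "0 < orient u v x" "0 < orient v w x"
      using uv vw x by (auto simp: ccw_edges_def)
    ultimately have "x \<in> convex hull {u, v, w}"
      using D by (intro mem_triangle_if_orient_nonneg) auto
    moreover have "{u, v, w} \<subseteq> V - {x}" using mem x by auto
    ultimately show False using conv[of x] x hull_mono by blast
  qed
qed

section \<open>Cutting off a vertex\<close>

text \<open>
  The chord \<open>u w\<close> separates the triangle \<open>u v w\<close> from all other points, so the two pieces overlap
  in a null set only. They cover the hull: a point \<open>x\<close> of it lies on a segment from \<open>v\<close> to some \<open>q\<close>
  spanned by the other points, and if \<open>x\<close> is beyond the chord, it lies in the triangle \<open>u w q\<close>.\<close>

lemma area_cut_vertex:
  assumes fin: "finite V" and uv: "(u, v) \<in> ccw_edges V" and vw: "(v, w) \<in> ccw_edges V"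
    and D: "0 < orient u v w" and uw: "\<And>x. x \<in> V - {u, v, w} \<Longrightarrow> 0 < orient u w x"
  shows "area (convex hull V) = area (convex hull (V - {v})) + orient u v w / 2"
proof -
  define Q where "Q = convex hull (V - {v})"
  define T where "T = convex hull {u, v, w}"
  have mem: "u \<in> V" "v \<in> V" "w \<in> V" "u \<noteq> v" "v \<noteq> w" "u \<noteq> w"
    using uv vw D by (auto simp: ccw_edges_def)
  have uwv: "orient u w v = - orient u v w" by (simp add: orient_def algebra_simps)
  have Q: "0 \<le> orient u v q" "0 \<le> orient v w q" "0 \<le> orient u w q" if "q \<in> Q" for q
  proof -
    have "Q \<subseteq> {x. 0 \<le> orient u v x}" unfolding Q_def
      using ccw_edges_orient_nonneg[OF uv] by (intro hull_minimal convex_orient_ge) auto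
    moreover have "Q \<subseteq> {x. 0 \<le> orient v w x}" unfolding Q_def
      using ccw_edges_orient_nonneg[OF vw] by (intro hull_minimal convex_orient_ge) auto
    moreover have "Q \<subseteq> {x. 0 \<le> orient u w x}" unfolding Q_def
    proof (intro hull_minimal convex_orient_ge subsetI)
      show "x \<in> {x. 0 \<le> orient u w x}" if "x \<in> V - {v}" for x
        using uw[of x] that by (cases "x \<in> {u, w}") auto
    qed
    ultimately show "0 \<le> orient u v q" "0 \<le> orient v w q" "0 \<le> orient u w q"
      using that by auto
  qed
  have "convex hull V \<subseteq> Q \<union> T"
  proof
    fix x assume x: "x \<in> convex hull V"
    have "V = insert v (V - {v})" "V - {v} \<noteq> {}" using mem by auto
    then obtain q t where q: "q \<in> Q" "0 \<le> t" "t \<le> 1" "x = (1 - t) *\<^sub>R v + t *\<^sub>R q"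
      using x convex_hull_insert_alt[of v "V - {v}"] by (auto simp: Q_def)
    have ox: "orient u v x = t * orient u v q" "orient v w x = t * orient v w q"
      "orient u w x = t * orient u w q - (1 - t) * orient u v w"
      using uwv by (simp_all add: q(4) orient_affine)
    show "x \<in> Q \<union> T"
    proof (cases "0 < orient u w x")
      case False
      then have "0 \<le> orient w u x" using orient_swap[of u w x] by linarith
      then have "x \<in> T" unfolding T_def
        using D ox Q[OF q(1)] q by (intro mem_triangle_if_orient_nonneg) auto
      then show ?thesis ..
    next
      case True
      have "0 < orient u w q"
      proof (rule ccontr)
        assume "\<not> 0 < orient u w q"
        then have "t * orient u w q \<le> 0" using q by (simp add: mult_le_0_iff)
        moreover have "0 \<le> (1 - t) * orient u v w" using q D by simp
        ultimately show False using True ox by linarith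
      qed
      moreover have "orient w q x = (1 - t) * orient v w q" "orient q u x = (1 - t) * orient u v q"
        using orient_rotate by (simp_all add: q(4) orient_affine)
      ultimately have "x \<in> convex hull {u, w, q}"
        using True Q[OF q(1)] q by (intro mem_triangle_if_orient_nonneg) auto
      also have "\<dots> \<subseteq> Q"
        using q mem by (intro hull_minimal) (auto simp: Q_def intro: hull_inc)
      finally show ?thesis ..
    qed
  qed
  moreover have "Q \<union> T \<subseteq> convex hull V"
    unfolding Q_def T_def using mem by (intro Un_least hull_mono) auto
  ultimately have union: "convex hull V = Q \<union> T" by blast
  have comp: "compact Q" "compact T"
    using fin by (auto simp: Q_def T_def intro!: finite_imp_compact_convex_hull)
  have "T \<subseteq> {x. orient w u x \<ge> 0}"
    unfolding T_def using D orient_rotate[of v w u] orient_rotate[of u v w]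
    by (intro hull_minimal convex_orient_ge) auto
  then have "Q \<inter> T \<subseteq> {x. orient u w x = 0}"
    using Q(3) orient_swap[of u w] by fastforce
  then have "negligible (Q \<inter> T)"
    using negligible_orient_zero[OF \<open>u \<noteq> w\<close>] negligible_subset by blast
  then have "measure lebesgue (Q \<union> T) = measure lebesgue Q + measure lebesgue T"
    using comp by (subst measure_Un3) (auto simp: lmeasurable_compact negligible_imp_measure0)
  moreover have "measure lebesgue T = measure lborel T"
    using comp by (intro measure_completion) (auto dest: compact_imp_closed)
  moreover have "measure lborel T = orient u v w / 2"
    using D unfolding T_def content_triangle orient_def by (simp add: algebra_simps)
  ultimately show ?thesis by (simp add: area_def union Q_def)
qed

section \<open>Sliding a vertex parallel to the chord of its neighbours\<close>

text \<open>
  Strict convexity of the distance to \<open>u\<close> along a line that misses \<open>u\<close>: the strict triangle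
  inequality applied to \<open>v + d - u\<close> and \<open>v - d - u\<close>.\<close>

lemma dist_sum_slide_less:
  fixes u v d :: "real ^ 2"
  assumes "orient u v (v + d) \<noteq> 0"
  shows "2 * dist u v < dist u (v + d) + dist u (v - d)"
proof -
  have "\<not> collinear {0, (v + d) - u, (v - d) - u}"
    using assms by (auto simp: collinear_iff_orient orient_def algebra_simps)
  then have "norm ((v + d - u) + (v - d - u)) \<noteq> norm (v + d - u) + norm (v - d - u)"
    using norm_triangle_eq_imp_collinear by blast
  then have "norm ((v + d - u) + (v - d - u)) < norm (v + d - u) + norm (v - d - u)"
    using norm_triangle_ineq[of "v + d - u" "v - d - u"] by linarith
  moreover have "(v + d - u) + (v - d - u) = 2 *\<^sub>R (v - u)"
    by (simp add: scaleR_2)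
  ultimately show ?thesis
    by (simp add: dist_norm norm_minus_commute[of u])
qed

text \<open>
  Finitely many determinants depend continuously on the displacement, so those that are positive
  remain so.\<close>

lemma eventually_orient_preserving_slide:
  assumes "finite V"
  shows "\<forall>\<^sub>F t in nhds (0::real). orient_preserving_on V (\<lambda>x. if x = v then v + t *\<^sub>R d else x)"
proof -
  define f where "f t x = (if x = v then v + t *\<^sub>R d else x)" for t :: real and x
  have lim: "((\<lambda>t. f t x) \<longlongrightarrow> x) (nhds 0)" for x
  proof -
    have "((\<lambda>t. v + t *\<^sub>R d) \<longlongrightarrow> v + 0 *\<^sub>R d) (nhds 0)"
      by (intro tendsto_intros) (simp add: filterlim_ident)
    then show ?thesis by (cases "x = v") (simp_all add: f_def)
  qed
  have "((\<lambda>t. orient (f t a) (f t b) (f t c)) \<longlongrightarrow> orient a b c) (nhds 0)" for a b c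
    unfolding orient_def by (intro tendsto_intros lim)
  then have "\<forall>\<^sub>F t in nhds 0. 0 < orient a b c \<longrightarrow> 0 < orient (f t a) (f t b) (f t c)" for a b c
    by (cases "0 < orient a b c") (auto dest: order_tendstoD(1))
  then have "\<forall>\<^sub>F t in nhds 0. orient_preserving_on V (f t)"
    unfolding orient_preserving_on_def by (intro eventually_ball_finite assms ballI)
  then show ?thesis by (simp add: f_def[abs_def])
qed

section \<open>Optimal polygons are inscribed\<close>

text \<open>
  Krein-Milman recovers the polygon from its vertices, and a two-dimensional set is not spanned by
  fewer than three points.\<close>

lemma general_position_vertices:
  assumes P: "convex_polygon P"
  shows "general_position (vertices P)" "P = convex hull (vertices P)"
    and "\<And>x. x \<in> vertices P \<Longrightarrow> x \<notin> convex hull (vertices P - {x})"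
proof -
  have "polytope P" "aff_dim P = 2" using P by (auto simp: convex_polygon_def)
  then have "compact P" "convex P"
    by (auto simp: polytope_imp_compact polytope_imp_convex)
  then show hull: "P = convex hull (vertices P)"
    unfolding vertices_def by (rule Krein_Milman_Minkowski)
  have fin: "finite (vertices P)"
    unfolding vertices_def
    using \<open>polytope P\<close> by (intro finite_polyhedron_extreme_points polytope_imp_polyhedron)
  have "aff_dim (vertices P) = 2"
    using \<open>aff_dim P = 2\<close> hull aff_dim_convex_hull by metis
  then have "2 \<le> int (card (vertices P)) - 1"
    using aff_dim_le_card[OF fin] by simp
  moreover have "orient a b c \<noteq> 0"
    if "a \<in> vertices P" "b \<in> vertices P" "c \<in> vertices P" "a \<noteq> b" "b \<noteq> c" "a \<noteq> c" for a b c
    using vertices_not_collinear[OF that] by (simp add: collinear_iff_orient)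
  ultimately show "general_position (vertices P)"
    using fin by (auto simp: general_position_def)
  fix x assume x: "x \<in> vertices P"
  then have "convex (P - {x})" "x \<in> P"
    using \<open>convex P\<close> by (auto simp: vertices_def extreme_point_of_stillconvex)
  moreover have "vertices P - {x} \<subseteq> P - {x}"
    by (auto simp: vertices_def extreme_point_of_def)
  ultimately have "convex hull (vertices P - {x}) \<subseteq> P - {x}"
    by (intro hull_minimal)
  then show "x \<notin> convex hull (vertices P - {x})" by auto
qed

text \<open>
  Both displacements, by \<open>s\<close> and by \<open>- s\<close>, give admissible polygons of the same area, and the
  average of their perimeters exceeds that of \<open>P\<close>; so one of them is longer.\<close>

lemma exists_larger_perimeter:
  assumes P: "convex_polygon P" and v: "v \<in> vertices P"
    and sub: "P \<subseteq> \<Omega>" and "convex \<Omega>" and int: "v \<in> interior \<Omega>"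
  obtains P' where "convex_polygon P'" "card (sides P') = card (sides P)" "P' \<subseteq> \<Omega>"
    "area P' = area P" "perimeter P < perimeter P'"
proof -
  define V where "V = vertices P"
  have V: "general_position V" and hull: "P = convex hull V"
    and conv: "\<And>x. x \<in> V \<Longrightarrow> x \<notin> convex hull (V - {x})"
    using general_position_vertices[OF P] by (auto simp: V_def)
  have fin: "finite V" using V by (simp add: general_position_def)
  have vV: "v \<in> V" using v by (simp add: V_def)
  obtain u w where uv: "(u, v) \<in> ccw_edges V" and vw: "(v, w) \<in> ccw_edges V"
    using exists_ccw_neighbour[OF V vV conv[OF vV]] by blast
  note D = orient_neighbours(1)[OF V conv uv vw]
  note uwx = orient_neighbours(2)[OF V conv uv vw]
  have mem: "u \<in> V" "w \<in> V" "u \<noteq> v" "v \<noteq> w" "u \<noteq> w"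
    using uv vw D by (auto simp: ccw_edges_def)
  define f where "f t x = (if x = v then v + t *\<^sub>R (w - u) else x)" for t :: real and x
  (* Admissible displacements: the sides persist and the moved vertex stays in \<Omega>. *)
  define good where "good t \<longleftrightarrow> orient_preserving_on V (f t) \<and> f t v \<in> \<Omega>" for t
  have "\<forall>\<^sub>F t in nhds 0. orient_preserving_on V (f t)"
    using eventually_orient_preserving_slide[OF fin] by (simp add: f_def[abs_def])
  moreover have "((\<lambda>t. v + t *\<^sub>R (w - u)) \<longlongrightarrow> v + 0 *\<^sub>R (w - u)) (nhds 0)"
    by (intro tendsto_intros) (simp add: filterlim_ident)
  then have "\<forall>\<^sub>F t in nhds 0. f t v \<in> interior \<Omega>"
    using int by (auto simp: f_def dest!: topological_tendstoD[OF _ open_interior])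
  ultimately have "\<forall>\<^sub>F t in nhds 0. good t"
    unfolding good_def by eventually_elim (use interior_subset in blast)
  then obtain \<delta> where "\<delta> > 0" "\<And>t. dist t 0 < \<delta> \<Longrightarrow> good t"
    by (auto simp: eventually_nhds_metric)
  then obtain s where s: "0 < s" "good s" "good (- s)"
    using that[of "\<delta> / 2"] by (auto simp: dist_real_def)
  have polygon: "convex_polygon (convex hull f t ` V)" "convex hull f t ` V \<subseteq> \<Omega>"
    "card (sides (convex hull f t ` V)) = card (sides P)" if "good t" for t
  proof -
    have op: "orient_preserving_on V (f t)" "f t v \<in> \<Omega>" using that by (auto simp: good_def)
    show "convex_polygon (convex hull f t ` V)"
      using convex_polygon_hull orient_preserving_general_position[OF V op(1)] by blast
    show "card (sides (convex hull f t ` V)) = card (sides P)"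
      using card_sides_image[OF V op(1)] hull by simp
    have "V \<subseteq> \<Omega>" using sub hull hull_subset[of V convex] by blast
    then show "convex hull f t ` V \<subseteq> \<Omega>"
      using op(2) by (intro hull_minimal \<open>convex \<Omega>\<close>) (auto simp: f_def)
  qed
  have area: "area (convex hull f t ` V) = area P" if "good t" for t
  proof -
    have op: "orient_preserving_on V (f t)" using that by (simp add: good_def)
    have unmoved: "f t x = x" if "x \<noteq> v" for x using that by (simp add: f_def)
    have inj: "inj_on (f t) V" by (rule orient_preserving_inj_on[OF V op])
    have edges: "(u, f t v) \<in> ccw_edges (f t ` V)" "(f t v, w) \<in> ccw_edges (f t ` V)"
      using bij_betw_apply[OF ccw_edges_image[OF V op] uv]
        bij_betw_apply[OF ccw_edges_image[OF V op] vw] mem by (auto simp: unmoved)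
    have rest: "f t ` V - {f t v} = V - {v}"
      using inj_on_image_set_diff[OF inj, of V "{v}"] vV by (auto simp: unmoved)
    have D': "orient u (f t v) w = orient u v w"
      by (simp add: f_def orient_def algebra_simps)
    have "area (convex hull f t ` V) = area (convex hull (V - {v})) + orient u v w / 2"
      using area_cut_vertex[OF finite_imageI[OF fin] edges] D D' rest uwx by auto
    also have "\<dots> = area P"
      using area_cut_vertex[OF fin uv vw D uwx] hull by simp
    finally show ?thesis .
  qed
  define g where "g t = (\<Sum>(a, b)\<in>ccw_edges V. dist (f t a) (f t b))" for t
  have perim: "perimeter (convex hull f t ` V) = g t" if "good t" for t
    using perimeter_image[OF V] that by (simp add: good_def g_def)
  have finE: "finite (ccw_edges V)"
    using finite_cartesian_product[OF fin fin] by (rule rev_finite_subset) (auto simp: ccw_edges_def)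
  (* Only the two sides at v change their length. *)
  have split: "g t = dist u (v + t *\<^sub>R (w - u)) + dist w (v + t *\<^sub>R (w - u))
      + (\<Sum>(a, b)\<in>ccw_edges V - {(u, v), (v, w)}. dist a b)" for t
  proof -
    let ?E = "ccw_edges V - {(u, v), (v, w)}"
    have "ccw_edges V = insert (u, v) (insert (v, w) ?E)"
      using uv vw by auto
    then have "g t = (\<Sum>(a, b)\<in>insert (u, v) (insert (v, w) ?E). dist (f t a) (f t b))"
      unfolding g_def by simp
    also have "\<dots> = dist (f t u) (f t v) + dist (f t v) (f t w)
        + (\<Sum>(a, b)\<in>?E. dist (f t a) (f t b))"
      using finE mem by simp
    also have "(\<Sum>(a, b)\<in>?E. dist (f t a) (f t b)) = (\<Sum>(a, b)\<in>?E. dist a b)"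
    proof (rule sum.cong)
      fix p assume p: "p \<in> ?E"
      obtain a b where [simp]: "p = (a, b)" by fastforce
      have "a \<noteq> v" "b \<noteq> v"
        using p ccw_edges_unique[OF vw] ccw_edges_unique'[OF uv] by auto
      then show "(case p of (a, b) \<Rightarrow> dist (f t a) (f t b)) = (case p of (a, b) \<Rightarrow> dist a b)"
        by (simp add: f_def)
    qed simp
    finally show ?thesis using mem by (simp add: f_def dist_commute)
  qed
  have "f 0 = id" by (auto simp: f_def)
  then have "perimeter P = g 0"
    using perimeter_eq_sum_ccw_edges[OF V] hull by (simp add: g_def)
  moreover have "2 * dist u v < dist u (v + s *\<^sub>R (w - u)) + dist u (v - s *\<^sub>R (w - u))"
    "2 * dist w v < dist w (v + s *\<^sub>R (w - u)) + dist w (v - s *\<^sub>R (w - u))"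
  proof -
    have "orient u v (v + s *\<^sub>R (w - u)) = s * orient u v w"
      "orient w v (v + s *\<^sub>R (w - u)) = s * orient u v w"
      by (simp_all add: orient_def algebra_simps)
    then show "2 * dist u v < dist u (v + s *\<^sub>R (w - u)) + dist u (v - s *\<^sub>R (w - u))"
      "2 * dist w v < dist w (v + s *\<^sub>R (w - u)) + dist w (v - s *\<^sub>R (w - u))"
      using D s by (auto intro!: dist_sum_slide_less)
  qed
  then have "2 * g 0 < g s + g (- s)"
    by (simp add: split)
  ultimately have "perimeter P < g s \<or> perimeter P < g (- s)"
    by linarith
  then obtain t where "good t" "perimeter P < g t"
    using s by blast
  then show thesis
    using that[of "convex hull f t ` V"] polygon area perim by simp
qed

theorem theorem2:
  fixes \<Omega> :: "(real ^ 2) set" and n :: nat and A :: real and Pmax :: "(real ^ 2) set"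
  assumes "bounded \<Omega>" "convex \<Omega>"
    and "\<not> (\<exists>a b. \<Omega> \<subseteq> closed_segment a b)"
    and "n \<ge> 3"
    and "A \<in> {0<..<area \<Omega>}"
    and "is_arg_max perimeter
           (\<lambda>P. convex_polygon P \<and> card (sides P) \<le> n \<and> P \<subseteq> \<Omega> \<and> area P = A) Pmax"
  shows "vertices Pmax \<subseteq> frontier \<Omega>"
proof (rule subsetI, rule ccontr)
  fix v assume v: "v \<in> vertices Pmax" and notin: "v \<notin> frontier \<Omega>"
  have P: "convex_polygon Pmax" "card (sides Pmax) \<le> n" "Pmax \<subseteq> \<Omega>" "area Pmax = A"
    and max: "\<And>P'. \<lbrakk>convex_polygon P'; card (sides P') \<le> n; P' \<subseteq> \<Omega>; area P' = A\<rbrakk>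
                \<Longrightarrow> \<not> perimeter Pmax < perimeter P'"
    using assms(6) unfolding is_arg_max_def by blast+
  have "v \<in> \<Omega>" using v P(3) by (auto simp: vertices_def extreme_point_of_def)
  then have "v \<in> interior \<Omega>"
    using notin closure_subset[of \<Omega>] by (auto simp: frontier_def)
  then obtain P' where "convex_polygon P'" "card (sides P') = card (sides Pmax)" "P' \<subseteq> \<Omega>"
    "area P' = area Pmax" "perimeter Pmax < perimeter P'"
    using exists_larger_perimeter[OF P(1) v P(3) assms(2)] by blast
  then show False using max P by auto
qed

end
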